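(* A finite point-line geometry $(\mathcal X,\mathcal L)$ is quasi-projective if and only if it is a geometry without lines, or a geometry in which every two distinct points lie on a singular line, or a geometry in which every point lies on a regular line.
   Context: A point-line geometry is a pair $(\mathcal X,\mathcal L)$ with $\mathcal X$ a nonempty finite set of points and $\mathcal L\subseteq\mathcal P(\mathcal X)$ a set of lines, such that every line contains at least two points and every two distinct points lie on at most one line. A line with exactly two points is singular; a line with more than two points is regular. A map $f:\mathcal X\to\mathcal Y$ is a homomorphism from $(\mathcal X,\mathcal L)$ to $(\mathcal Y,\mathcal K)$ if for every $l\in\mathcal L$ either $|f(l)|=1$ or there is $k\in\mathcal K$ with $f(l)\subseteq k$; an epimorphism is a surjective homomorphism. A geometry $\mathcal S$ is quasi-projective if for every point-line geometry $\mathcal T$, every homomorphism $f:\mathcal S\to\mathcal T$ and every epimorphism $j:\mathcal S\to\mathcal T$, there is an endomorphism $\phi$ of $\mathcal S$ with $j\circ\phi=f$.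
   Formalization: The third alternative is taken as "all points lie on one common regular line" (two disjoint 3-point lines refute the pointwise reading); the target geometries T have natural numbers as points, which covers all finite geometries up to isomorphism. *)

theory Defs
  imports Main
begin

locale point_line_geometry =
  fixes X :: "'a set" and L :: "'a set set"
  assumes points_nonempty: "X \<noteq> {}"
    and points_finite: "finite X"
    and line_subset: "l \<in> L \<Longrightarrow> l \<subseteq> X"
    and line_card: "l \<in> L \<Longrightarrow> card l \<ge> 2"
    and line_unique: "\<lbrakk>x \<in> X; y \<in> X; x \<noteq> y; k \<in> L; l \<in> L; x \<in> k; y \<in> k; x \<in> l; y \<in> l\<rbrakk> \<Longrightarrow> k = l"

definition singular_line :: "'a set \<Rightarrow> bool" where
  "singular_line l \<longleftrightarrow> card l = 2"

definition regular_line :: "'a set \<Rightarrow> bool" where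
  "regular_line l \<longleftrightarrow> card l > 2"

definition geom_hom :: "'a set \<Rightarrow> 'a set set \<Rightarrow> 'b set \<Rightarrow> 'b set set \<Rightarrow> ('a \<Rightarrow> 'b) \<Rightarrow> bool" where
  "geom_hom X L Y K f \<longleftrightarrow>
     f ` X \<subseteq> Y \<and> (\<forall>l\<in>L. card (f ` l) = 1 \<or> (\<exists>k\<in>K. f ` l \<subseteq> k))"

definition geom_epi :: "'a set \<Rightarrow> 'a set set \<Rightarrow> 'b set \<Rightarrow> 'b set set \<Rightarrow> ('a \<Rightarrow> 'b) \<Rightarrow> bool" where
  "geom_epi X L Y K j \<longleftrightarrow> geom_hom X L Y K j \<and> j ` X = Y"

text \<open>
  A definition in HOL cannot quantify over all types, so the codomain geometry ranges over those
  with points in \<^typ>\<open>nat\<close>. Geometries are finite, so these represent every geometry up to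
  isomorphism; the lemma \<open>quasi_projective_lift\<close> below recovers the lifting property for codomain
  geometries over an arbitrary type.
\<close>
definition quasi_projective :: "'a set \<Rightarrow> 'a set set \<Rightarrow> bool" where
  "quasi_projective X L \<longleftrightarrow>
     (\<forall>(Y :: nat set) K f j.
        point_line_geometry Y K \<longrightarrow> geom_hom X L Y K f \<longrightarrow> geom_epi X L Y K j \<longrightarrow>
        (\<exists>\<phi>. geom_hom X L X L \<phi> \<and> (\<forall>x\<in>X. j (\<phi> x) = f x)))"

lemma point_line_geometry_image:
  assumes "point_line_geometry Y K" and g: "inj_on g Y"
  shows "point_line_geometry (g ` Y) ((`) g ` K)"
proof -
  interpret point_line_geometry Y K by fact
  show ?thesis
  proof
    show "g ` Y \<noteq> {}" using points_nonempty by simp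
    show "finite (g ` Y)" using points_finite by simp
    show "l \<subseteq> g ` Y" if "l \<in> (`) g ` K" for l
      using that line_subset by blast
    show "card l \<ge> 2" if l: "l \<in> (`) g ` K" for l
    proof -
      obtain m where m: "m \<in> K" "l = g ` m" using l by blast
      have "inj_on g m" using g line_subset[OF m(1)] inj_on_subset by blast
      then show ?thesis using m line_card[OF m(1)] by (simp add: card_image)
    qed
    show "k = l" if A: "x \<in> g ` Y" "y \<in> g ` Y" "x \<noteq> y" "k \<in> (`) g ` K" "l \<in> (`) g ` K"
      "x \<in> k" "y \<in> k" "x \<in> l" "y \<in> l" for x y k l
    proof -
      obtain u v where uv: "u \<in> Y" "v \<in> Y" "x = g u" "y = g v" using A(1,2) by blast
      obtain m n where mn: "m \<in> K" "n \<in> K" "k = g ` m" "l = g ` n" using A(4,5) by blast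
      have "u \<in> m" "v \<in> m" "u \<in> n" "v \<in> n"
        using A(6-9) inj_on_image_mem_iff[OF g uv(1) line_subset] inj_on_image_mem_iff[OF g uv(2) line_subset]
        unfolding uv(3,4) mn(3,4) using mn(1,2) by simp_all
      then have "m = n" using line_unique[of u v m n] uv mn A(3) by blast
      then show ?thesis using mn by simp
    qed
  qed
qed

lemma geom_hom_image:
  assumes "geom_hom X L Y K f" and "inj_on g Y" and "\<And>l. l \<in> L \<Longrightarrow> l \<subseteq> X"
  shows "geom_hom X L (g ` Y) ((`) g ` K) (g \<circ> f)"
  unfolding geom_hom_def
proof (intro conjI ballI)
  show "(g \<circ> f) ` X \<subseteq> g ` Y" using assms(1) by (auto simp: geom_hom_def)
  fix l assume l: "l \<in> L"
  have sub: "f ` l \<subseteq> Y" using assms(1) assms(3)[OF l] by (auto simp: geom_hom_def)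
  have "card ((g \<circ> f) ` l) = card (f ` l)"
    unfolding image_comp[symmetric] by (rule card_image[OF inj_on_subset[OF assms(2) sub]])
  moreover have "card (f ` l) = 1 \<or> (\<exists>k\<in>K. f ` l \<subseteq> k)"
    using assms(1) l by (auto simp: geom_hom_def)
  ultimately show "card ((g \<circ> f) ` l) = 1 \<or> (\<exists>k\<in>(`) g ` K. (g \<circ> f) ` l \<subseteq> k)"
    by (fastforce simp: image_comp[symmetric] simp del: image_comp)
qed

lemma quasi_projective_lift:
  fixes X :: "'a set" and Y :: "'b set"
  assumes "point_line_geometry X L" and "quasi_projective X L" and "point_line_geometry Y K"
    and "geom_hom X L Y K f" and "geom_epi X L Y K j"
  shows "\<exists>\<phi>. geom_hom X L X L \<phi> \<and> (\<forall>x\<in>X. j (\<phi> x) = f x)"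
proof -
  have "finite Y" using assms(3) by (rule point_line_geometry.points_finite)
  then obtain g :: "'b \<Rightarrow> nat" where g: "inj_on g Y"
    using finite_imp_inj_to_nat_seg by blast
  note ls = point_line_geometry.line_subset[OF assms(1)]
  have "geom_epi X L (g ` Y) ((`) g ` K) (g \<circ> j)"
    using assms(5) geom_hom_image[OF _ g ls] unfolding geom_epi_def image_comp[symmetric] by simp
  then obtain \<phi> where \<phi>: "geom_hom X L X L \<phi>" "\<forall>x\<in>X. (g \<circ> j) (\<phi> x) = (g \<circ> f) x"
    using assms(2) point_line_geometry_image[OF assms(3) g] geom_hom_image[OF assms(4) g ls]
    unfolding quasi_projective_def by blast
  have "j (\<phi> x) = f x" if x: "x \<in> X" for x
  proof -
    have "\<phi> x \<in> X" using \<phi>(1) x by (auto simp: geom_hom_def)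
    then have "j (\<phi> x) \<in> Y" using assms(5) by (auto simp: geom_epi_def)
    moreover have "f x \<in> Y" using assms(4) x by (auto simp: geom_hom_def)
    ultimately show ?thesis using \<phi>(2) x inj_onD[OF g] by simp
  qed
  then show ?thesis using \<phi>(1) by blast
qed

end

theory Submission
  imports Defs
begin

text \<open>
  Since the geometry on \<open>X\<close> whose only line is \<open>X\<close> admits every map as a homomorphism, lifting
  through the identity onto it shows that a quasi-projective geometry has every self-map of \<open>X\<close> as
  an endomorphism; conversely, composing with a section of the epimorphism then gives all lifts.
  If every self-map is an endomorphism and there is a line, then moving two of its points
  arbitrarily makes any two points collinear, and a line with at least three points can be mapped
  onto any three points, which forces it to be all of \<open>X\<close>.
\<close>

lemma quasi_projective_iff_all_maps_hom:
  assumes "point_line_geometry X L"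
  shows "quasi_projective X L \<longleftrightarrow> (\<forall>\<phi>. \<phi> ` X \<subseteq> X \<longrightarrow> geom_hom X L X L \<phi>)"
proof
  interpret point_line_geometry X L by fact
  assume qp: "quasi_projective X L"
  show "\<forall>\<phi>. \<phi> ` X \<subseteq> X \<longrightarrow> geom_hom X L X L \<phi>"
  proof (intro allI impI)
    fix \<phi> assume \<phi>: "\<phi> ` X \<subseteq> X"
    show "geom_hom X L X L \<phi>"
    proof (cases "L = {}")
      case True
      then show ?thesis using \<phi> by (simp add: geom_hom_def)
    next
      case False
      then obtain l where "l \<in> L" by blast
      then have "card X \<ge> 2"
        using line_card line_subset card_mono[OF points_finite] by (meson order_trans)
      then have T: "point_line_geometry X {X}"
        using points_nonempty points_finite by unfold_locales auto
      have "geom_hom X L X {X} \<phi>" "geom_epi X L X {X} (\<lambda>x. x)"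
        using \<phi> line_subset by (auto simp: geom_hom_def geom_epi_def)
      from quasi_projective_lift[OF assms qp T this]
      obtain \<psi> where \<psi>: "geom_hom X L X L \<psi>" "\<forall>x\<in>X. \<psi> x = \<phi> x" by blast
      then have "\<phi> ` l = \<psi> ` l" if "l \<in> L" for l
        using line_subset[OF that] by (auto intro!: image_cong)
      then show ?thesis using \<psi>(1) \<phi> by (simp add: geom_hom_def)
    qed
  qed
next
  assume all: "\<forall>\<phi>. \<phi> ` X \<subseteq> X \<longrightarrow> geom_hom X L X L \<phi>"
  show "quasi_projective X L"
    unfolding quasi_projective_def
  proof (intro allI impI)
    fix Y :: "nat set" and K f j
    assume "geom_hom X L Y K f" "geom_epi X L Y K j"
    then have f: "f x \<in> j ` X" if "x \<in> X" for x
      using that by (auto simp: geom_hom_def geom_epi_def)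
    define \<phi> where "\<phi> = inv_into X j \<circ> f"
    have "\<phi> ` X \<subseteq> X" using f by (auto simp: \<phi>_def inv_into_into)
    moreover have "\<forall>x\<in>X. j (\<phi> x) = f x" using f by (simp add: \<phi>_def f_inv_into_f)
    ultimately show "\<exists>\<phi>. geom_hom X L X L \<phi> \<and> (\<forall>x\<in>X. j (\<phi> x) = f x)"
      using all by blast
  qed
qed

lemma geom_hom_image_line:
  assumes "geom_hom X L Y K f" and "l \<in> L" and "x \<in> f ` l" and "y \<in> f ` l" and "x \<noteq> y"
  obtains k where "k \<in> K" and "f ` l \<subseteq> k"
proof -
  have "card (f ` l) \<noteq> 1" using assms(3-5) by (metis card_1_singletonE singletonD)
  then show ?thesis using assms(1,2) that by (auto simp: geom_hom_def)
qed

theorem theorem6p2: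
  fixes X :: "'a set" and L :: "'a set set"
  assumes "point_line_geometry X L"
  shows "quasi_projective X L \<longleftrightarrow>
    L = {}
    \<or> (\<forall>x\<in>X. \<forall>y\<in>X. x \<noteq> y \<longrightarrow> (\<exists>l\<in>L. singular_line l \<and> x \<in> l \<and> y \<in> l))
    \<or> (\<exists>l\<in>L. regular_line l \<and> (\<forall>x\<in>X. x \<in> l))"
    (is "_ \<longleftrightarrow> _ \<or> ?S \<or> ?R")
proof -
  interpret point_line_geometry X L by fact
  have "L = {} \<or> ?S \<or> ?R" if all: "\<forall>\<phi>. \<phi> ` X \<subseteq> X \<longrightarrow> geom_hom X L X L \<phi>"
  proof (cases "\<exists>l\<in>L. regular_line l")
    case True
    then obtain l where l: "l \<in> L" "card l > 2" by (auto simp: regular_line_def)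
    then have "Suc (Suc (Suc 0)) \<le> card l" by simp
    then obtain a b c where abc: "a \<in> l" "b \<in> l" "c \<in> l" "a \<noteq> b" "a \<noteq> c" "b \<noteq> c"
      by (auto simp: card_le_Suc_iff)
    have "z \<in> l" if z: "z \<in> X" for z
    proof -
      define \<phi> where "\<phi> = (\<lambda>x. if x = a then a else if x = b then b else z)"
      have "\<phi> ` X \<subseteq> X" using abc l(1) line_subset z by (auto simp: \<phi>_def)
      moreover have im: "a \<in> \<phi> ` l" "b \<in> \<phi> ` l" "z \<in> \<phi> ` l"
        using abc by (auto simp: \<phi>_def image_iff)
      ultimately obtain k where k: "k \<in> L" "\<phi> ` l \<subseteq> k"
        using all geom_hom_image_line[OF _ l(1) im(1,2) abc(4)] by blast
      have "k = l" using line_unique[of a b k l] im k l(1) abc line_subset by blast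
      then show ?thesis using k(2) im(3) by blast
    qed
    then show ?thesis using l by (auto simp: regular_line_def)
  next
    case False
    then have sing: "singular_line l" if "l \<in> L" for l
      using line_card[OF that] that le_neq_implies_less[of 2 "card l"]
      by (auto simp: singular_line_def regular_line_def)
    have ?S if l: "l \<in> L" for l
    proof (intro ballI impI)
      fix x y assume xy: "x \<in> X" "y \<in> X" "x \<noteq> y"
      obtain a b where ab: "a \<in> l" "b \<in> l" "a \<noteq> b"
        using sing[OF l] by (auto simp: singular_line_def card_2_iff)
      define \<phi> where "\<phi> = (\<lambda>z. if z = a then x else y)"
      have "\<phi> ` X \<subseteq> X" using xy by (auto simp: \<phi>_def)
      moreover have im: "x \<in> \<phi> ` l" "y \<in> \<phi> ` l" using ab by (auto simp: \<phi>_def)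
      ultimately obtain k where "k \<in> L" "\<phi> ` l \<subseteq> k"
        using all geom_hom_image_line[OF _ l im xy(3)] by blast
      then show "\<exists>l\<in>L. singular_line l \<and> x \<in> l \<and> y \<in> l" using im sing by blast
    qed
    then show ?thesis by blast
  qed
  moreover have "geom_hom X L X L \<phi>" if "L = {} \<or> ?S \<or> ?R" and \<phi>: "\<phi> ` X \<subseteq> X" for \<phi>
    using that(1)
  proof (elim disjE)
    assume "L = {}"
    then show ?thesis using \<phi> by (simp add: geom_hom_def)
  next
    assume S: ?S
    have "card (\<phi> ` l) = 1 \<or> (\<exists>k\<in>L. \<phi> ` l \<subseteq> k)" if l: "l \<in> L" for l
    proof -
      obtain a b where ab: "a \<in> l" "b \<in> l" "a \<noteq> b"
        using line_card[OF l] by (auto simp: numeral_eq_Suc card_le_Suc_iff)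
      then have X: "a \<in> X" "b \<in> X" using line_subset[OF l] by auto
      then obtain m where m: "m \<in> L" "singular_line m" "a \<in> m" "b \<in> m"
        using S ab(3) by blast
      then have "m = l" using line_unique[of a b m l] X ab l by blast
      then have "l = {a, b}" using m(2) ab by (auto simp: singular_line_def card_2_iff)
      then have im: "\<phi> ` l = {\<phi> a, \<phi> b}" by simp
      show ?thesis
      proof (cases "\<phi> a = \<phi> b")
        case True
        then show ?thesis using im by simp
      next
        case False
        moreover have "\<phi> a \<in> X" "\<phi> b \<in> X" using X \<phi> by auto
        ultimately obtain k where "k \<in> L" "\<phi> a \<in> k" "\<phi> b \<in> k" using S by blast
        then show ?thesis using im by auto
      qed
    qed
    then show ?thesis using \<phi> by (simp add: geom_hom_def)
  next
    assume ?R
    then obtain k where "k \<in> L" "X \<subseteq> k" by blast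
    moreover have "\<phi> ` l \<subseteq> X" if "l \<in> L" for l using \<phi> line_subset[OF that] by blast
    ultimately show ?thesis using \<phi> unfolding geom_hom_def by (meson order_trans)
  qed
  ultimately show ?thesis
    unfolding quasi_projective_iff_all_maps_hom[OF assms] by (intro iffI allI impI)
qed

end
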